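(* Let $p$ be an analytic function on the open unit disk $\mathbb{D}=\{z\in\mathbb{C}:|z|<1\}$, normalized such that $p(0)=1$, and let $0\le\alpha<1$. If \[ \left| zp'(z)+ \frac{1+\alpha}{1-\alpha}\,p(z)- \frac{1}{1-\alpha}\,p(z)^2 - \frac{\alpha}{1-\alpha}\right| < \frac{1-\alpha}{2} \quad \text{for all } z\in\mathbb{D}, \] then $\operatorname{Re} p(z)>\alpha$ for all $z\in\mathbb{D}$.
   Context: $\mathbb{D}$ denotes the open unit disk in the complex plane; $\alpha$ is a real number. *)

theory Defs
  imports "HOL-Complex_Analysis.Complex_Analysis"
begin

end

theory Submission imports Defs begin

text \<open>
  Subtracting \<open>\<alpha>\<close> and rescaling, \<open>p = \<alpha> + (1 - \<alpha>) q\<close>, makes the parameter disappear: the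
  hypothesis becomes \<open>\<bar>z q' + q - q\<^sup>2\<bar> < 1/2\<close> with \<open>q(0) = 1\<close>, and the claim becomes \<open>Re q > 0\<close>.

  If the claim fails, \<open>Re q\<close> vanishes at some point \<open>z\<close> of least modulus, so \<open>Re q > 0\<close> on the open
  disk of radius \<open>\<bar>z\<bar>\<close> and \<open>q z = \<i>y\<close>. On the circle through \<open>z\<close> the function \<open>Re q\<close> has a minimum
  at \<open>z\<close>, which makes \<open>z q'(z)\<close> real. Inside the disk the Schwarz lemma for the Cayley transform
  \<open>(1 - q) / (1 + q)\<close> bounds from below how fast \<open>Re q\<close> must decrease along the radius to \<open>z\<close>:
  \<open>z q'(z) = -s\<close> with \<open>s \<ge> (1 + y\<^sup>2) / 2\<close>. This is the half-plane form of Jack's lemma,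
  \<open>Jack_right_half_plane\<close> below, resting on \<open>Schwarz_right_half_plane\<close>. Then
  \<open>\<bar>z q' + q - q\<^sup>2\<bar>\<^sup>2 = (s - y\<^sup>2)\<^sup>2 + y\<^sup>2\<close>. This is at least \<open>1\<close> when \<open>y\<^sup>2 \<ge> 1\<close>, and otherwise at
  least \<open>((1 - y\<^sup>2) / 2)\<^sup>2 + y\<^sup>2 = ((1 + y\<^sup>2) / 2)\<^sup>2 \<ge> 1/4\<close>, contradicting the hypothesis.
\<close>

text \<open>The Schwarz lemma for \<open>(1 - q) / (1 + q)\<close>, which maps the disk into the unit disk because
  \<open>1\<close> is closer than \<open>-1\<close> to every point of the right half-plane.\<close>

lemma Schwarz_right_half_plane:
  assumes hol: "q holomorphic_on ball 0 r" and "q 0 = 1"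
    and pos: "\<And>z. cmod z < r \<Longrightarrow> Re (q z) > 0"
    and t: "0 \<le> t" "t < 1" and z: "cmod z = r" "r > 0"
  shows "cmod (1 - q (of_real t * z)) \<le> t * cmod (1 + q (of_real t * z))"
proof -
  define w where "w = (\<lambda>u. (1 - q (u * z)) / (1 + q (u * z)))"
  have inside: "cmod (u * z) < r" if "cmod u < 1" for u
    using that z by (simp add: norm_mult)
  have nz: "1 + q (u * z) \<noteq> 0" if "cmod u < 1" for u
    using pos[OF inside[OF that]] by (auto simp: complex_eq_iff)
  have "(\<lambda>u. q (u * z)) holomorphic_on ball 0 1"
    using holomorphic_on_compose_gen[of "\<lambda>u. u * z" "ball 0 1" q "ball 0 r"] hol inside
    by (force simp: o_def intro!: holomorphic_intros)
  then have holw: "w holomorphic_on ball 0 1"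
    unfolding w_def using nz by (intro holomorphic_intros) auto
  have w0: "w 0 = 0"
    using \<open>q 0 = 1\<close> by (simp add: w_def)
  have wlt: "cmod (w u) < 1" if "cmod u < 1" for u
  proof -
    have "(cmod (1 - q (u * z)))\<^sup>2 < (cmod (1 + q (u * z)))\<^sup>2"
      unfolding cmod_power2 using pos[OF inside[OF that]]
      by (simp add: power2_eq_square algebra_simps)
    then show ?thesis
      using nz[OF that] by (simp add: w_def norm_divide power2_less_imp_less)
  qed
  have "cmod (w (of_real t)) \<le> t"
    using Schwarz_Lemma(1)[OF holw w0 wlt, of "of_real t"] t by simp
  then show ?thesis
    using nz[of "of_real t"] t by (simp add: w_def norm_divide divide_le_eq)
qed

lemma has_real_derivative_Re_Im_along_path:
  assumes "(q has_field_derivative d) (at (g t))" "(g has_vector_derivative g') (at t)"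
  shows "((\<lambda>t. Re (q (g t))) has_real_derivative Re (g' * d)) (at t)"
    and "((\<lambda>t. Im (q (g t))) has_real_derivative Im (g' * d)) (at t)"
proof -
  have "((\<lambda>t. q (g t)) has_vector_derivative g' * d) (at t)"
    using field_vector_diff_chain_at[OF assms(2,1)] by (simp add: o_def)
  from bounded_linear.has_vector_derivative[OF bounded_linear_Re this]
    bounded_linear.has_vector_derivative[OF bounded_linear_Im this]
  show "((\<lambda>t. Re (q (g t))) has_real_derivative Re (g' * d)) (at t)"
    and "((\<lambda>t. Im (q (g t))) has_real_derivative Im (g' * d)) (at t)"
    by (simp_all add: has_real_derivative_iff_has_vector_derivative)
qed

text \<open>At a boundary zero \<open>z\<close> of \<open>Re q\<close>, the tangential derivative of \<open>Re q\<close> vanishes because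
  \<open>Re q \<ge> 0\<close> on the whole circle, and the Schwarz bound, an equality at \<open>z\<close> itself, can be
  differentiated along the radius.\<close>

lemma Jack_right_half_plane:
  assumes hol: "q holomorphic_on ball 0 R" and "q 0 = 1" and z: "z \<noteq> 0" "cmod z < R"
    and pos: "\<And>u. cmod u < cmod z \<Longrightarrow> Re (q u) > 0" and zero: "Re (q z) = 0"
  shows "Im (z * deriv q z) = 0" and "Re (z * deriv q z) \<le> - (1 + (Im (q z))\<^sup>2) / 2"
proof -
  have der: "(q has_field_derivative deriv q z) (at z)"
    using holomorphic_derivI[OF hol open_ball] z by simp
  have nonneg: "Re (q u) \<ge> 0" if u: "cmod u = cmod z" for u
  proof -
    have "isCont q u"
      using holomorphic_on_imp_continuous_on[OF hol] u z
      by (simp add: continuous_on_eq_continuous_at)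
    then have "isCont (\<lambda>t::real. q (of_real t * u)) 1"
      using isCont_o2[of 1 "\<lambda>t::real. of_real t * u" q] by simp
    then have "isCont (\<lambda>t::real. Re (q (of_real t * u))) 1"
      by (rule continuous_Re)
    then have lim: "((\<lambda>t::real. Re (q (of_real t * u))) \<longlongrightarrow> Re (q u)) (at_left 1)"
      unfolding isCont_def using tendsto_within_subset[OF _ subset_UNIV] by fastforce
    have "eventually (\<lambda>t::real. t \<in> {0<..<1}) (at_left 1)"
      by (rule eventually_at_leftI[of 0]) auto
    then have "eventually (\<lambda>t::real. Re (q (of_real t * u)) \<ge> 0) (at_left 1)"
    proof eventually_elim
      case (elim t)
      then have "cmod (of_real t * u) < cmod z"
        using u z by (simp add: norm_mult)
      then show ?case
        using pos less_imp_le by blast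
    qed
    then show ?thesis
      using tendsto_lowerbound[OF lim] by simp
  qed
  show "Im (z * deriv q z) = 0"
  proof -
    define g where "g = (\<lambda>\<theta>::real. z * exp (\<i> * of_real \<theta>))"
    have "(g has_vector_derivative z * \<i>) (at 0)"
      unfolding g_def by (auto intro!: derivative_eq_intros has_vector_derivative_real_field)
    then have "((\<lambda>\<theta>. Re (q (g \<theta>))) has_real_derivative Re (z * \<i> * deriv q z)) (at 0)"
      using der by (intro has_real_derivative_Re_Im_along_path) (simp_all add: g_def)
    moreover have "\<forall>\<theta>. \<bar>0 - \<theta>\<bar> < 1 \<longrightarrow> Re (q (g 0)) \<le> Re (q (g \<theta>))"
      using nonneg zero by (simp add: g_def norm_mult)
    ultimately have "Re (z * \<i> * deriv q z) = 0"
      using DERIV_local_min[OF _ zero_less_one] by blast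
    then show ?thesis
      by (simp add: algebra_simps)
  qed
  show "Re (z * deriv q z) \<le> - (1 + (Im (q z))\<^sup>2) / 2"
  proof -
    define a where "a = (\<lambda>t::real. Re (q (of_real t * z)))"
    define b where "b = (\<lambda>t::real. Im (q (of_real t * z)))"
    \<comment> \<open>\<open>f t = t\<^sup>2 \<bar>1 + q\<bar>\<^sup>2 - \<bar>1 - q\<bar>\<^sup>2\<close> at \<open>t z\<close> is nonnegative for \<open>t < 1\<close> and zero at \<open>1\<close>,
      so its derivative at \<open>1\<close> cannot be positive.\<close>
    define f where "f = (\<lambda>t. t\<^sup>2 * ((1 + a t)\<^sup>2 + (b t)\<^sup>2) - ((1 - a t)\<^sup>2 + (b t)\<^sup>2))"
    have g: "((\<lambda>t::real. of_real t * z) has_vector_derivative z) (at 1)"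
      by (auto intro!: derivative_eq_intros has_vector_derivative_real_field)
    have da: "(a has_real_derivative Re (z * deriv q z)) (at 1)"
      and db: "(b has_real_derivative Im (z * deriv q z)) (at 1)"
      unfolding a_def b_def using der
      by (intro has_real_derivative_Re_Im_along_path g; simp)+
    have a1: "a 1 = 0" and b1: "b 1 = Im (q z)"
      using zero by (simp_all add: a_def b_def)
    have df: "(f has_real_derivative 2 * (1 + (Im (q z))\<^sup>2) + 4 * Re (z * deriv q z)) (at 1)"
      unfolding f_def
      by (rule derivative_eq_intros da db refl)+ (simp add: a1 b1 algebra_simps)
    have f1: "f 1 = 0"
      by (simp add: f_def a1)
    have fge: "f t \<ge> 0" if t: "0 \<le> t" "t < 1" for t
    proof -
      have "q holomorphic_on ball 0 (cmod z)"
        using z by (intro holomorphic_on_subset[OF hol]) auto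
      then have "cmod (1 - q (of_real t * z)) \<le> t * cmod (1 + q (of_real t * z))"
        using assms t by (intro Schwarz_right_half_plane) auto
      then have "(cmod (1 - q (of_real t * z)))\<^sup>2 \<le> (t * cmod (1 + q (of_real t * z)))\<^sup>2"
        by (intro power_mono) auto
      then show ?thesis
        by (simp add: f_def a_def b_def power_mult_distrib cmod_power2)
    qed
    have "\<not> 2 * (1 + (Im (q z))\<^sup>2) + 4 * Re (z * deriv q z) > 0"
    proof
      assume "2 * (1 + (Im (q z))\<^sup>2) + 4 * Re (z * deriv q z) > 0"
      from DERIV_pos_inc_left[OF df this] obtain e
        where e: "e > 0" "\<And>h. 0 < h \<Longrightarrow> h < e \<Longrightarrow> f (1 - h) < 0"
        using f1 by auto
      define h where "h = min (e / 2) (1 / 2)"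
      have "0 < h" "h < e" "h < 1"
        using e(1) by (auto simp: h_def min_def)
      then show False
        using e(2)[of h] fge[of "1 - h"] by simp
    qed
    then show ?thesis
      by (simp add: field_simps)
  qed
qed

text \<open>A point of least modulus with \<open>Re q \<le> 0\<close> exists by compactness; there \<open>Re q\<close> vanishes, since
  otherwise the intermediate value theorem on the radius would give a zero closer to the origin.\<close>

lemma least_modulus_zero_of_Re:
  assumes hol: "q holomorphic_on ball 0 R" and "Re (q 0) > 0"
    and z1: "cmod z1 < R" "Re (q z1) \<le> 0"
  obtains z where "z \<noteq> 0" "cmod z < R" "Re (q z) = 0" "\<And>u. cmod u < cmod z \<Longrightarrow> Re (q u) > 0"
proof -
  define K where "K = {u \<in> cball 0 (cmod z1). Re (q u) \<le> 0}"
  have cont: "continuous_on (ball 0 R) q"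
    using hol by (rule holomorphic_on_imp_continuous_on)
  have contR: "continuous_on (cball 0 (cmod z1)) (\<lambda>u. Re (q u))"
    using z1 by (intro continuous_intros continuous_on_subset[OF cont]) auto
  have "compact K"
    unfolding K_def compact_eq_bounded_closed
    using continuous_on_closed_Collect_le[OF contR continuous_on_const closed_cball, of 0]
    by (auto intro: bounded_subset[OF bounded_cball[of 0 "cmod z1"]])
  moreover have "z1 \<in> K"
    using z1 by (simp add: K_def)
  ultimately obtain z where zK: "z \<in> K" and zmin: "\<And>u. u \<in> K \<Longrightarrow> cmod z \<le> cmod u"
    using continuous_attains_inf[of K cmod] continuous_on_norm_id by auto
  have zR: "cmod z < R" and zz1: "cmod z \<le> cmod z1" and zle: "Re (q z) \<le> 0"
    using zK z1 by (auto simp: K_def)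
  have pos: "Re (q u) > 0" if "cmod u < cmod z" for u
    using zmin[of u] that zz1 by (force simp: K_def)
  have z0: "z \<noteq> 0"
    using zle assms(2) by auto
  have "\<exists>t\<ge>0. t \<le> 1 \<and> Re (q (of_real t * z)) = 0"
  proof (rule IVT2')
    have "continuous_on ((\<lambda>t::real. of_real t * z) ` {0..1}) (\<lambda>u. Re (q u))"
      using zz1 by (intro continuous_on_subset[OF contR])
        (auto simp: norm_mult intro: order_trans[OF mult_left_le_one_le[OF norm_ge_zero]])
    then show "continuous_on {0..1} (\<lambda>t::real. Re (q (of_real t * z)))"
      by (rule continuous_on_compose2) (auto intro!: continuous_intros)
  qed (use zle assms(2) in auto)
  then obtain t where t: "0 \<le> t" "t \<le> 1" "Re (q (of_real t * z)) = 0"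
    by auto
  then have "\<not> cmod (of_real t * z) < cmod z"
    using pos[of "of_real t * z"] by auto
  then have "t = 1"
    using t z0 by (simp add: norm_mult)
  then show ?thesis
    using that z0 zR pos t by simp
qed

theorem Re_pos_if_cmod_zderiv_bound:
  assumes hol: "q holomorphic_on ball 0 1" and "q 0 = 1"
    and bound: "\<And>z. cmod z < 1 \<Longrightarrow> cmod (z * deriv q z + q z - (q z)\<^sup>2) < 1 / 2"
    and "cmod z1 < 1"
  shows "Re (q z1) > 0"
proof (rule ccontr)
  assume "\<not> Re (q z1) > 0"
  then obtain z where z: "z \<noteq> 0" "cmod z < 1" "Re (q z) = 0"
    and pos: "\<And>u. cmod u < cmod z \<Longrightarrow> Re (q u) > 0"
    using least_modulus_zero_of_Re[OF hol, of z1] assms by auto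
  define y s where "y = Im (q z)" and "s = - Re (z * deriv q z)"
  have "Im (z * deriv q z) = 0" and s: "s \<ge> (1 + y\<^sup>2) / 2"
    using Jack_right_half_plane[OF hol \<open>q 0 = 1\<close> z(1,2) pos z(3)]
    by (simp_all add: y_def s_def)
  then have zq: "z * deriv q z = of_real (- s)" and qz: "q z = \<i> * of_real y"
    using z(3) by (simp_all only: complex_eq_iff) (simp_all add: y_def s_def)
  have "z * deriv q z + q z - (q z)\<^sup>2 = Complex (y\<^sup>2 - s) y"
    unfolding zq qz by (simp add: complex_eq_iff power2_eq_square)
  then have eq: "(cmod (z * deriv q z + q z - (q z)\<^sup>2))\<^sup>2 = (s - y\<^sup>2)\<^sup>2 + y\<^sup>2"
    by (simp add: cmod_power2 power2_commute)
  have "(s - y\<^sup>2)\<^sup>2 + y\<^sup>2 \<ge> (1 / 2)\<^sup>2"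
  proof (cases "y\<^sup>2 \<ge> 1")
    case True
    have "(1 / 2 :: real)\<^sup>2 \<le> 1"
      by (simp add: power2_eq_square)
    then show ?thesis
      using True zero_le_power2[of "s - y\<^sup>2"] by linarith
  next
    case False
    have "((1 - y\<^sup>2) / 2)\<^sup>2 \<le> (s - y\<^sup>2)\<^sup>2"
      using s False by (intro power_mono) (auto simp: field_simps)
    moreover have "((1 - y\<^sup>2) / 2)\<^sup>2 + y\<^sup>2 = ((1 + y\<^sup>2) / 2)\<^sup>2"
      by (simp add: power2_eq_square field_simps)
    moreover have "(1 / 2)\<^sup>2 \<le> ((1 + y\<^sup>2) / 2)\<^sup>2"
      by (intro power_mono) auto
    ultimately show ?thesis
      by linarith
  qed
  then have "1 / 2 \<le> cmod (z * deriv q z + q z - (q z)\<^sup>2)"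
    unfolding eq[symmetric] by (rule power2_le_imp_le) simp
  then show False
    using bound[OF z(2)] by simp
qed

theorem theorem4:
  fixes p :: "complex \<Rightarrow> complex" and \<alpha> :: real
  assumes "p analytic_on ball 0 1"
    and "p 0 = 1"
    and "0 \<le> \<alpha>" and "\<alpha> < 1"
    and "\<And>z. z \<in> ball 0 1 \<Longrightarrow>
      cmod (z * deriv p z + of_real ((1 + \<alpha>) / (1 - \<alpha>)) * p z
        - of_real (1 / (1 - \<alpha>)) * (p z)\<^sup>2 - of_real (\<alpha> / (1 - \<alpha>))) < (1 - \<alpha>) / 2"
  shows "\<forall>z \<in> ball 0 1. Re (p z) > \<alpha>"
proof
  fix z1 :: complex
  assume z1: "z1 \<in> ball 0 1"
  define c :: complex where "c = of_real (1 - \<alpha>)"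
  define q where "q = (\<lambda>z. (p z - of_real \<alpha>) / c)"
  have c0: "c \<noteq> 0" and \<alpha>c: "of_real \<alpha> = 1 - c" and cmodc: "cmod c = 1 - \<alpha>"
    using \<open>\<alpha> < 1\<close> by (simp_all add: c_def norm_of_real del: of_real_diff) (simp add: of_real_diff)
  have hol: "p holomorphic_on ball 0 1"
    using assms(1) by (rule analytic_imp_holomorphic)
  have "Re (q z1) > 0"
  proof (rule Re_pos_if_cmod_zderiv_bound[where q = q])
    show "q holomorphic_on ball 0 1"
      unfolding q_def using c0 by (intro holomorphic_intros hol) auto
    show "q 0 = 1"
      using c0 \<open>p 0 = 1\<close> by (simp add: q_def \<alpha>c)
    show "cmod z1 < 1"
      using z1 by simp
    show "cmod (z * deriv q z + q z - (q z)\<^sup>2) < 1 / 2" if z: "cmod z < 1" for z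
    proof -
      have "(p has_field_derivative deriv p z) (at z)"
        using holomorphic_derivI[OF hol open_ball] z by simp
      then have "(q has_field_derivative deriv p z / c) (at z)"
        unfolding q_def using c0 by (auto intro!: derivative_eq_intros)
      then have dq: "deriv q z = deriv p z / c"
        by (rule DERIV_imp_deriv)
      \<comment> \<open>Up to the factor \<open>1 / (1 - \<alpha>)\<close>, the terms without derivative are \<open>-(p - 1) (p - \<alpha>)\<close>, and
        \<open>p - 1\<close> and \<open>p - \<alpha>\<close> are \<open>1 - \<alpha>\<close> times \<open>q - 1\<close> and \<open>q\<close>.\<close>
      have "z * deriv p z + of_real ((1 + \<alpha>) / (1 - \<alpha>)) * p z
          - of_real (1 / (1 - \<alpha>)) * (p z)\<^sup>2 - of_real (\<alpha> / (1 - \<alpha>))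
        = z * deriv p z + (2 - c) / c * p z - 1 / c * (p z)\<^sup>2 - (1 - c) / c"
        by (simp add: c_def)
      also have "\<dots> = c * (z * deriv q z + q z - (q z)\<^sup>2)"
        unfolding dq unfolding q_def \<alpha>c using c0 by (simp add: field_simps power2_eq_square)
      finally have "(1 - \<alpha>) * cmod (z * deriv q z + q z - (q z)\<^sup>2) < (1 - \<alpha>) * (1 / 2)"
        using assms(5)[of z] z cmodc by (simp add: norm_mult)
      then show ?thesis
        using \<open>\<alpha> < 1\<close> by (simp only: mult_less_cancel_left_pos diff_gt_0_iff_gt)
    qed
  qed
  moreover have "Re (q z1) = (Re (p z1) - \<alpha>) / (1 - \<alpha>)"
    unfolding q_def c_def by (simp only: Re_divide_of_real) simp
  ultimately show "Re (p z1) > \<alpha>"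
    using \<open>\<alpha> < 1\<close> by (simp add: zero_less_divide_iff)
qed

end
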